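(* Let $k\ge 1$ and $m\ge 1$ be integers. For any tree $T$ of order $m$, every $k$-connected cograph $G$ with $$\delta(G)\ge \begin{cases} k+m-[k=1] & \text{if } n'_G=1,\\ k+m-1+\left\lfloor \frac{n'_G}{2}\right\rfloor & \text{if } 2\le n'_G\le k,\\ \left\lfloor \frac{3k}{2}\right\rfloor+m-1 & \text{if } k<n'_G<k+m,\\ k+m-1 & \text{if } n'_G\ge k+m\end{cases}$$ contains a subtree $T'\cong T$ such that $G-V(T')$ is $k$-connected.
   Context: Graphs are finite, simple and undirected. The order of a graph is its number of vertices; $\delta(G)$ is the minimum degree. $[P]$ is Iverson's convention: $1$ if the statement $P$ is true and $0$ otherwise. Cographs are defined recursively: $K_1$ is a cograph; the disjoint union of cographs is a cograph; the join of cographs is a cograph, where the join $G_1+G_2$ of vertex-disjoint graphs is obtained from their disjoint union by adding all edges between $V(G_1)$ and $V(G_2)$. (Equivalently, cographs are the graphs with no induced path $P_4$ on four vertices.) A nontrivial connected cograph $G$ (nontrivial means of order at least 2) decomposes uniquely as a join $G=G_1+\cdots+G_t$ with $t\ge 2$ in which each $G_i$ is either $K_1$ or a disconnected cograph; the $G_i$ are the cocomponents of $G$, and a cocomponent of largest order is called a primary cocomponent. If $G\cong K_1$ or $G$ is a disconnected cograph, then $G$ itself is regarded as its only, primary, cocomponent. $n'_G$ denotes the order of a primary cocomponent of $G$. The connectivity $\kappa(G)$ is the minimum number of vertices whose removal from $G$ results in a disconnected graph or a trivial graph (a graph of order 1); in particular $\kappa(K_1)=0$. $G$ is $k$-connected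 if $\kappa(G)\ge k$, with the additional convention that $K_1$ is regarded as 1-connected. For a proper subset $S\subsetneq V(G)$, $G-S$ is the graph obtained by deleting all vertices of $S$. A subtree of $G$ is a (not necessarily induced) subgraph that is a tree. *)

theory Defs
  imports Main "Graph_Theory.Graph_Theory"
begin

text \<open>
  Finite simple undirected graphs are represented as in the \<open>Graph_Theory\<close> library:
  \<^locale>\<open>pair_graph\<close> describes finite, loop-free digraphs whose arcs form a symmetric relation, so
  an undirected edge \<open>uv\<close> is the pair of arcs \<open>(u, v)\<close> and \<open>(v, u)\<close>. The library declares
  \<^const>\<open>with_proj\<close> as an implicit coercion from \<^typ>\<open>'a pair_pre_digraph\<close> to
  \<^typ>\<open>('a, 'a \<times> 'a) pre_digraph\<close>. The null graph is not
  \<^const>\<open>connected\<close>.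
\<close>


definition graph_order :: "('a, 'b) pre_digraph \<Rightarrow> nat" where
  "graph_order G = card (verts G)"

text \<open>In a symmetric digraph the out-degree of a vertex is its degree as an undirected graph.\<close>

definition min_degree :: "('a, 'b) pre_digraph \<Rightarrow> nat" where
  "min_degree G = Min (out_degree G ` verts G)"

text \<open>
  The library's \<^const>\<open>tree\<close> forbids all directed cycles, and every undirected edge gives the
  directed cycle \<open>(u, v), (v, u)\<close>; the cycles of the undirected graph are the directed cycles of
  length at least 3.
\<close>

definition undirected_tree :: "'a pair_pre_digraph \<Rightarrow> bool" where
  "undirected_tree T \<longleftrightarrow> pair_graph T \<and> connected T \<and>
     \<not> (\<exists>p. pre_digraph.cycle T p \<and> 3 \<le> length p)"


definition connectivity :: "('a, 'b) pre_digraph \<Rightarrow> nat" where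
  "connectivity G = (LEAST n. \<exists>S. S \<subset> verts G \<and> card S = n \<and>
     (\<not> connected (G \<restriction> (verts G - S)) \<or> graph_order (G \<restriction> (verts G - S)) = 1))"

text \<open>The second disjunct is the convention that \<open>K\<^sub>1\<close> is 1-connected although its connectivity is 0.\<close>

definition k_connected :: "nat \<Rightarrow> ('a, 'b) pre_digraph \<Rightarrow> bool" where
  "k_connected k G \<longleftrightarrow> k \<le> connectivity G \<or> (k = 1 \<and> graph_order G = 1)"


definition disj_union ::
  "'a pair_pre_digraph \<Rightarrow> 'a pair_pre_digraph \<Rightarrow> 'a pair_pre_digraph" where
  "disj_union G H = \<lparr> pverts = pverts G \<union> pverts H, parcs = parcs G \<union> parcs H \<rparr>"

definition graph_join ::
  "'a pair_pre_digraph \<Rightarrow> 'a pair_pre_digraph \<Rightarrow> 'a pair_pre_digraph" where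
  "graph_join G H = \<lparr> pverts = pverts G \<union> pverts H,
     parcs = parcs G \<union> parcs H \<union> pverts G \<times> pverts H \<union> pverts H \<times> pverts G \<rparr>"

inductive cograph :: "'a pair_pre_digraph \<Rightarrow> bool" where
  single: "cograph \<lparr> pverts = {v}, parcs = {} \<rparr>"
| union: "cograph G \<Longrightarrow> cograph H \<Longrightarrow> pverts G \<inter> pverts H = {} \<Longrightarrow> cograph (disj_union G H)"
| join: "cograph G \<Longrightarrow> cograph H \<Longrightarrow> pverts G \<inter> pverts H = {} \<Longrightarrow> cograph (graph_join G H)"

text \<open>The join \<open>G\<^sub>1 + \<dots> + G\<^sub>t\<close> of the set \<open>{G\<^sub>1, \<dots>, G\<^sub>t}\<close> of vertex-disjoint graphs.\<close>

definition Join :: "'a pair_pre_digraph set \<Rightarrow> 'a pair_pre_digraph" where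
  "Join D = \<lparr> pverts = (\<Union>H\<in>D. pverts H),
     parcs = (\<Union>H\<in>D. parcs H) \<union> (\<Union>H\<in>D. \<Union>K\<in>D - {H}. pverts H \<times> pverts K) \<rparr>"

definition join_decomposition ::
  "'a pair_pre_digraph \<Rightarrow> 'a pair_pre_digraph set \<Rightarrow> bool" where
  "join_decomposition G D \<longleftrightarrow> finite D \<and> 2 \<le> card D \<and>
     (\<forall>H\<in>D. cograph H \<and> (graph_order H = 1 \<or> \<not> connected H)) \<and>
     pairwise (\<lambda>H K. pverts H \<inter> pverts K = {}) D \<and> G = Join D"

definition cocomponents :: "'a pair_pre_digraph \<Rightarrow> 'a pair_pre_digraph set" where
  "cocomponents G = (if graph_order G = 1 \<or> \<not> connected G then {G}
     else (THE D. join_decomposition G D))"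

definition primary_order :: "'a pair_pre_digraph \<Rightarrow> nat" where
  "primary_order G = Max ((\<lambda>H. graph_order (with_proj H)) ` cocomponents G)"


subsection \<open>The join decomposition exists and is unique\<close>

lemma cograph_pair_graph: "cograph G \<Longrightarrow> pair_graph G"
proof (induction rule: cograph.induct)
  case (single v)
  show ?case by unfold_locales (auto simp: symmetric_def sym_def)
next
  case (union G H)
  interpret G: pair_graph G by fact
  interpret H: pair_graph H by fact
  show ?case
    using G.pair_finite_verts H.pair_finite_verts G.pair_finite_arcs H.pair_finite_arcs
    by unfold_locales
      (auto simp: disj_union_def symmetric_def sym_def dest: G.in_arcsD1 G.in_arcsD2 H.in_arcsD1
        H.in_arcsD2 G.no_loops' H.no_loops' G.arcs_symmetric H.arcs_symmetric)
next
  case (join G H)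
  interpret G: pair_graph G by fact
  interpret H: pair_graph H by fact
  show ?case
    using G.pair_finite_verts H.pair_finite_verts G.pair_finite_arcs H.pair_finite_arcs join.hyps(3)
    by unfold_locales
      (auto simp: graph_join_def symmetric_def sym_def dest: G.in_arcsD1 G.in_arcsD2 H.in_arcsD1
        H.in_arcsD2 G.no_loops' H.no_loops' G.arcs_symmetric H.arcs_symmetric)
qed

lemma cograph_nonempty: "cograph G \<Longrightarrow> pverts G \<noteq> {}"
  by (induction rule: cograph.induct) (auto simp: disj_union_def graph_join_def)

lemma connected_pair_graph:
  assumes "pair_graph G"
  shows "connected G \<longleftrightarrow>
    pverts G \<noteq> {} \<and> (\<forall>u\<in>pverts G. \<forall>v\<in>pverts G. (u, v) \<in> rtrancl_on (pverts G) (parcs G))"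
proof -
  interpret pair_graph G by fact
  have "(parcs G)\<^sup>s = parcs G" using arcs_symmetric by (auto simp: symcl_def)
  then show ?thesis by (simp add: connected_conv)
qed

lemma disj_union_not_connected:
  assumes "cograph G" "cograph H" "pverts G \<inter> pverts H = {}"
  shows "\<not> connected (disj_union G H)"
proof
  assume con: "connected (disj_union G H)"
  interpret G: pair_graph G by (rule cograph_pair_graph) fact
  interpret H: pair_graph H by (rule cograph_pair_graph) fact
  obtain u v where uv: "u \<in> pverts G" "v \<in> pverts H"
    using cograph_nonempty assms by blast
  have "pair_graph (disj_union G H)"
    using assms by (intro cograph_pair_graph cograph.union)
  then have "(u, v) \<in> rtrancl_on (pverts (disj_union G H)) (parcs (disj_union G H))"
    using con uv by (auto simp: connected_pair_graph disj_union_def)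
  then have "v \<in> pverts G"
  proof (induction rule: rtrancl_on_induct)
    case base
    show ?case by (rule uv(1))
  next
    case (step y z)
    then show ?case using assms(3)
      by (auto simp: disj_union_def dest: G.in_arcsD2 H.in_arcsD1)
  qed
  then show False using uv assms(3) by auto
qed

text \<open>Two non-adjacent vertices of a join lie in the same part.\<close>

lemma join_decomposition_same_part:
  assumes "join_decomposition G D" "u \<in> pverts G" "v \<in> pverts G" "(u, v) \<notin> parcs G"
    and "K \<in> D" "u \<in> pverts K"
  shows "v \<in> pverts K"
  using assms by (auto simp: join_decomposition_def Join_def)

lemma join_decomposition_arcs:
  assumes "join_decomposition G D" "H \<in> D"
  shows "parcs H = parcs G \<inter> (pverts H \<times> pverts H)"
proof -
  have in_part: "u \<in> pverts K \<and> v \<in> pverts K" if "K \<in> D" "(u, v) \<in> parcs K" for K u v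
  proof -
    interpret pair_graph K
      using assms that by (intro cograph_pair_graph) (auto simp: join_decomposition_def)
    show ?thesis using that in_arcsD1 in_arcsD2 by auto
  qed
  have same: "K = H" if "K \<in> D" "u \<in> pverts K" "u \<in> pverts H" for K u
    using assms that by (auto simp: join_decomposition_def pairwise_def)
  have arcs: "parcs G = (\<Union>K\<in>D. parcs K) \<union> (\<Union>K\<in>D. \<Union>L\<in>D - {K}. pverts K \<times> pverts L)"
    using assms by (simp add: join_decomposition_def Join_def)
  show ?thesis
  proof
    show "parcs H \<subseteq> parcs G \<inter> (pverts H \<times> pverts H)"
      using in_part assms(2) arcs by auto
    show "parcs G \<inter> (pverts H \<times> pverts H) \<subseteq> parcs H"
    proof clarify
      fix u v assume uv: "(u, v) \<in> parcs G" "u \<in> pverts H" "v \<in> pverts H"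
      then consider K where "K \<in> D" "(u, v) \<in> parcs K"
        | K L where "K \<in> D" "L \<in> D" "L \<noteq> K" "u \<in> pverts K" "v \<in> pverts L"
        using arcs by auto
      then show "(u, v) \<in> parcs H"
        by cases (use in_part same uv in blast)+
    qed
  qed
qed

lemma join_decomposition_refines:
  assumes D: "join_decomposition G D" and D': "join_decomposition G D'" and H: "H \<in> D"
  shows "\<exists>K\<in>D'. pverts H \<subseteq> pverts K"
proof -
  have pg: "pair_graph H" and ne: "pverts H \<noteq> {}"
    using D H by (auto simp: join_decomposition_def intro: cograph_pair_graph dest: cograph_nonempty)
  then interpret pair_graph H by simp
  have HG: "pverts H \<subseteq> pverts G" using D H by (auto simp: join_decomposition_def Join_def)
  have part: "\<exists>K\<in>D'. u \<in> pverts K" if "u \<in> pverts H" for u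
    using HG D' that by (auto simp: join_decomposition_def Join_def)
  show ?thesis
  proof (cases "graph_order H = 1")
    case True
    then obtain u where "pverts H = {u}" by (auto simp: graph_order_def card_1_singleton_iff)
    then show ?thesis using part by auto
  next
    case False
    then have "\<not> connected H" using D H by (auto simp: join_decomposition_def)
    then obtain u v where uv: "u \<in> pverts H" "v \<in> pverts H"
      "(u, v) \<notin> rtrancl_on (pverts H) (parcs H)"
      using ne pg by (auto simp: connected_pair_graph)
    obtain K where K: "K \<in> D'" "u \<in> pverts K" using part uv by auto
    have nonadj: "y \<in> pverts K"
      if "x \<in> pverts H" "y \<in> pverts H" "x \<in> pverts K" "(x, y) \<notin> parcs H" for x y
    proof (rule join_decomposition_same_part[OF D' _ _ _ K(1)])
      show "x \<in> pverts G" "y \<in> pverts G" using that HG by auto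
      show "(x, y) \<notin> parcs G" using that unfolding join_decomposition_arcs[OF D H] by simp
      show "x \<in> pverts K" by (rule that(3))
    qed
    have vK: "v \<in> pverts K"
      using nonadj[of u v] uv K rtrancl_on_into_rtrancl_on[of u u "pverts H" "parcs H" v] by auto
    have "x \<in> pverts K" if x: "x \<in> pverts H" for x
    proof (cases "(u, x) \<in> parcs H")
      case True
      then have "(u, x) \<in> rtrancl_on (pverts H) (parcs H)"
        using uv x rtrancl_on_into_rtrancl_on[of u u "pverts H" "parcs H" x] by auto
      then have "(v, x) \<notin> parcs H"
        using uv rtrancl_on_into_rtrancl_on[of u x "pverts H" "parcs H" v] arcs_symmetric by auto
      then show ?thesis using nonadj[of v x] uv vK x by auto
    next
      case False
      then show ?thesis using nonadj[of u x] uv K x by auto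
    qed
    then show ?thesis using K by auto
  qed
qed

lemma join_decomposition_subset:
  assumes D: "join_decomposition G D" and D': "join_decomposition G D'"
  shows "D \<subseteq> D'"
proof
  fix H assume H: "H \<in> D"
  obtain K where K: "K \<in> D'" "pverts H \<subseteq> pverts K"
    using join_decomposition_refines[OF D D' H] by auto
  obtain H' where H': "H' \<in> D" "pverts K \<subseteq> pverts H'"
    using join_decomposition_refines[OF D' D K(1)] by auto
  have "pverts H \<noteq> {}"
    using D H by (auto simp: join_decomposition_def dest: cograph_nonempty)
  then have "H' = H"
    using D H H' K unfolding join_decomposition_def pairwise_def by blast
  then have "pverts H = pverts K" using H' K by auto
  then have "H = K"
    using join_decomposition_arcs[OF D H] join_decomposition_arcs[OF D' K(1)]
    by (intro pair_pre_digraph.equality) auto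
  then show "H \<in> D'" using K by simp
qed

lemma join_decomposition_unique:
  "join_decomposition G D \<Longrightarrow> join_decomposition G D' \<Longrightarrow> D = D'"
  by (intro equalityI join_decomposition_subset)

lemma join_decomposition_exists:
  assumes "cograph G" "connected G" "graph_order G \<noteq> 1"
  shows "\<exists>D. join_decomposition G D"
  using assms
proof (induction rule: cograph.induct)
  case (single v)
  then show ?case by (simp add: graph_order_def)
next
  case (union G H)
  then show ?case using disj_union_not_connected by blast
next
  case (join G H)
  have parts: "\<exists>D. finite D \<and> D \<noteq> {} \<and>
      (\<forall>K\<in>D. cograph K \<and> (graph_order K = 1 \<or> \<not> connected K)) \<and>
      pairwise (\<lambda>H K. pverts H \<inter> pverts K = {}) D \<and> F = Join D"
    if F: "cograph F" and
      IH: "connected F \<Longrightarrow> graph_order F \<noteq> 1 \<Longrightarrow> \<exists>D. join_decomposition F D" for F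
  proof (cases "connected F \<and> graph_order F \<noteq> 1")
    case True
    then obtain D where "join_decomposition F D" using IH by auto
    then show ?thesis by (intro exI[of _ D]) (auto simp: join_decomposition_def)
  next
    case False
    then show ?thesis using F by (intro exI[of _ "{F}"]) (auto simp: Join_def)
  qed
  obtain A where A: "finite A" "A \<noteq> {}"
      "\<And>K. K \<in> A \<Longrightarrow> cograph K \<and> (graph_order K = 1 \<or> \<not> connected K)"
      "pairwise (\<lambda>H K. pverts H \<inter> pverts K = {}) A" "G = Join A"
    using parts[of G] join by auto
  obtain B where B: "finite B" "B \<noteq> {}"
      "\<And>K. K \<in> B \<Longrightarrow> cograph K \<and> (graph_order K = 1 \<or> \<not> connected K)"
      "pairwise (\<lambda>H K. pverts H \<inter> pverts K = {}) B" "H = Join B"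
    using parts[of H] join by auto
  have disj: "pverts K \<inter> pverts L = {}" if "K \<in> A" "L \<in> B" for K L
    using that A(5) B(5) join.hyps(3) by (auto simp: Join_def)
  have ne: "K \<noteq> L" if "K \<in> A" "L \<in> B" for K L
    using disj[OF that] cograph_nonempty A(3)[OF that(1)] by auto
  have "A \<inter> B = {}" using ne by auto
  then have "card (A \<union> B) = card A + card B" using A B by (simp add: card_Un_disjoint)
  moreover have "card A > 0" "card B > 0" using A B by (auto simp: card_gt_0_iff)
  ultimately have "2 \<le> card (A \<union> B)" by simp
  moreover have "pairwise (\<lambda>H K. pverts H \<inter> pverts K = {}) (A \<union> B)"
    using A(4) B(4) disj unfolding pairwise_def by (metis Int_commute Un_iff)
  moreover have "graph_join G H = Join (A \<union> B)"
  proof (rule pair_pre_digraph.equality)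
    show "parcs (graph_join G H) = parcs (Join (A \<union> B))" (is "?L = ?R")
    proof
      show "?L \<subseteq> ?R" using ne unfolding A(5) B(5) by (fastforce simp: graph_join_def Join_def)
      show "?R \<subseteq> ?L" unfolding A(5) B(5) by (fastforce simp: graph_join_def Join_def)
    qed
  qed (auto simp: graph_join_def Join_def A(5) B(5))
  ultimately have "join_decomposition (graph_join G H) (A \<union> B)"
    using A(1,3) B(1,3) by (auto simp: join_decomposition_def)
  then show ?case by blast
qed

lemma join_decomposition_cocomponents:
  assumes "cograph G" "connected G" "graph_order G \<noteq> 1"
  shows "join_decomposition G (cocomponents G)"
proof -
  have "\<exists>!D. join_decomposition G D"
    using join_decomposition_exists[OF assms] join_decomposition_unique by blast
  then have "join_decomposition G (THE D. join_decomposition G D)" by (rule theI')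
  then show ?thesis using assms by (simp add: cocomponents_def)
qed

end

theory Submission
  imports Defs
begin

text \<open>
  Let \<open>n\<close> be the order of \<open>G\<close>. A set \<open>R\<close> of vertices induces a \<open>k\<close>-connected graph as soon as
  \<open>k \<le> card (R - C)\<close> for every cocomponent \<open>C\<close>: after the removal of fewer than \<open>k\<close> vertices two
  cocomponents are still met. So it suffices to embed the tree with at most
  \<open>n - card C - k\<close> vertices outside each \<open>C\<close>. Embed greedily, one new leaf at a time, and call \<open>C\<close>
  tight if this budget is used up. If \<open>2 * k + m \<le> n\<close>, inclusion-exclusion shows that at most one
  cocomponent is tight; a minimum degree of at least \<open>k + m - 1\<close> then guarantees an unused neighbour
  of the parent inside the tight cocomponent.

  A smallest component of a primary cocomponent has at most half of its vertices, so
  \<open>2 * min_degree G + n' + 2 \<le> 2 * n\<close> when \<open>n' \<noteq> 1\<close>. This yields \<open>2 * k + m \<le> n\<close> if \<open>n' > k\<close>, and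
  \<open>k + m + n' \<le> n\<close> if \<open>2 \<le> n' \<le> k\<close>, where every embedding works. For \<open>n' = 1\<close> the graph is complete.
\<close>

subsection \<open>Trees\<close>

text \<open>An injection on the vertices induces a digraph isomorphism onto \<open>T'\<close>.
  Connectedness carries over along it, and a cycle of length at least 3 in \<open>T'\<close> would
  pull back to one in \<open>T\<close>. It turns a vertex embedding into the required
  subtree.\<close>

lemma undirected_tree_image:
  fixes T :: "'b pair_pre_digraph" and f :: "'b \<Rightarrow> 'a"
  assumes T: "undirected_tree T" and inj: "inj_on f (pverts T)"
  defines "T' \<equiv> \<lparr> pverts = f ` pverts T, parcs = map_prod f f ` parcs T \<rparr>"
  shows "undirected_tree T'" "digraph_iso T' T"
proof -
  interpret T: pair_graph T using T by (simp add: undirected_tree_def)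
  let ?hom = "\<lparr> iso_verts = f, iso_arcs = map_prod f f, iso_head = snd, iso_tail = fst \<rparr>"
  have "inj_on (map_prod f f) (pverts T \<times> pverts T)"
    using inj by (intro map_prod_inj_on)
  then have inj_arcs: "inj_on (map_prod f f) (parcs T)"
    by (rule inj_on_subset) (auto dest: T.in_arcsD1 T.in_arcsD2)
  have hom: "T.digraph_isomorphism ?hom"
    using inj inj_arcs by (auto simp: T.digraph_isomorphism_def T.wf_digraph_axioms)
  have T': "with_proj T' = app_iso ?hom T"
    by (auto simp: T'_def app_iso_def with_proj_def)
  have "digraph_iso T T'"
    using hom T' by (auto simp: digraph_iso_def)
  then show "digraph_iso T' T"
    by (metis T.wf_digraph_axioms digraph_iso_swap)
  have "f u \<noteq> f v" if "(u, v) \<in> parcs T" for u v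
    using that inj T.no_loops' T.in_arcsD1 T.in_arcsD2 by (metis inj_onD)
  then have pg: "pair_graph T'"
    using T.pair_finite_verts T.pair_finite_arcs inj
    by unfold_locales
      (auto simp: T'_def symmetric_def sym_def dest: T.in_arcsD1 T.in_arcsD2 T.arcs_symmetric
        intro: rev_image_eqI)
  then interpret T': pair_graph T' .
  have "connected T'"
    unfolding T' using T hom by (intro T.connectedI_app_iso) (auto simp: undirected_tree_def)
  moreover have "\<not> (T'.cycle p \<and> 3 \<le> length p)" for p
  proof
    assume p: "T'.cycle p \<and> 3 \<le> length p"
    then obtain u where u: "T'.awalk u p u" "distinct (tl (T'.awalk_verts u p))" "p \<noteq> []"
      by (auto simp: T'.cycle_def)
    \<comment> \<open>The inverse isomorphism maps arc by arc, so the length is kept; being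
      injective on vertices, it also keeps them distinct.\<close>
    let ?inv = "T.inv_iso ?hom"
    let ?q = "map (iso_arcs ?inv) p"
    have inv: "T'.digraph_isomorphism ?inv" and inv': "app_iso ?inv T' = T"
      unfolding T' by (rule T.digraph_isomorphism_invI[OF hom], rule T.app_iso_inv[OF hom])
    have w: "T.awalk (iso_verts ?inv u) ?q (iso_verts ?inv u)"
      using T'.awalk_app_isoI[OF u(1) inv] unfolding inv' .
    have "T.awalk_verts (iso_verts ?inv u) ?q = map (iso_verts ?inv) (T'.awalk_verts u p)"
      using T'.awalk_verts_app_iso_eq[OF inv u(1)] unfolding inv' by simp
    moreover have "inj_on (iso_verts ?inv) (pverts T')"
      using T'.digraph_isomorphism_inj_on_verts[OF inv] .
    moreover have "set (tl (T'.awalk_verts u p)) \<subseteq> pverts T'"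
      using T'.awalk_verts_in_verts[of u p] u(1)
      by (metis T'.awalk_def T'.awalk_verts_non_Nil list.set_sel(2) subsetI)
    ultimately have "distinct (tl (T.awalk_verts (iso_verts ?inv u) ?q))"
      using u(2) by (auto simp: map_tl[symmetric] distinct_map intro: inj_on_subset)
    then have "T.cycle ?q" using w u(3) by (auto simp: T.cycle_def)
    then show False using T p by (auto simp: undirected_tree_def)
  qed
  ultimately show "undirected_tree T'" using pg by (auto simp: undirected_tree_def)
qed

text \<open>A path inside \<open>W\<close> from \<open>w\<close> to \<open>w'\<close>, closed up
  through \<open>x\<close>, would be a cycle. Hence a vertex added to a connected part of the tree
  has only one arc to preserve, the one from its parent.\<close>

lemma undirected_tree_unique_neighbour:
  assumes T: "undirected_tree T" and W: "W \<subseteq> pverts T"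
    and con: "\<And>u v. u \<in> W \<Longrightarrow> v \<in> W \<Longrightarrow> (u, v) \<in> rtrancl_on W (parcs T)"
    and x: "x \<notin> W" and w: "w \<in> W" "(w, x) \<in> parcs T" and w': "w' \<in> W" "(w', x) \<in> parcs T"
  shows "w = w'"
proof (rule ccontr)
  assume ne: "w \<noteq> w'"
  interpret T: pair_graph T using T by (simp add: undirected_tree_def)
  \<comment> \<open>The path is taken in the subgraph induced on \<open>W\<close>, so that it cannot
    pass through \<open>x\<close>.\<close>
  define H where "H = \<lparr> pverts = W, parcs = parcs T \<inter> W \<times> W \<rparr>"
  interpret H: pair_wf_digraph H by unfold_locales (auto simp: H_def)
  have "(w, w') \<in> rtrancl_on W (parcs T \<inter> W \<times> W)"
    using con[OF w(1) w'(1)]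
  proof (induction rule: rtrancl_on_induct)
    case (step y z)
    then show ?case by (simp add: rtrancl_on_into_rtrancl_on[of w y W _ z])
  qed (use w in simp)
  then have "w \<rightarrow>\<^sup>*\<^bsub>with_proj H\<^esub> w'" by (simp add: reachable_def H_def)
  then obtain p where p: "H.apath w p w'" by (auto simp: H.reachable_apath)
  then have "H.awalk w p w'" by (auto simp: H.apath_def)
  then have Hw: "w \<in> pverts H" "set p \<subseteq> parcs H" "pcas w p w'" by (simp_all add: H.awalk_def)
  have W': "set (H.awalk_verts w p) \<subseteq> W"
    using H.awalk_verts_in_verts[OF Hw(1,2)] by (auto simp: H_def)
  have Tw: "T.awalk w p w'"
    using Hw W w by (auto simp: T.awalk_def H_def)
  have arcs: "(w', x) \<in> parcs T" "(x, w) \<in> parcs T"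
    using w w' T.arcs_symmetric by auto
  then have Tc: "T.awalk w (p @ [(w', x), (x, w)]) w"
    using Tw T.in_arcsD1 T.in_arcsD2 by (auto simp: T.awalk_simps)
  obtain vs where vs: "T.awalk_verts w p = w # vs"
    using Tw T.awhd_of_awalk[OF Tw] T.awalk_verts_non_Nil by (metis list.collapse)
  have "distinct (w # vs)" using p vs by (auto simp: H.apath_def)
  moreover have "T.awalk_verts w (p @ [(w', x), (x, w)]) = (w # vs) @ [x, w]"
    using T.awalk_verts_append[OF Tc] vs by simp
  ultimately have "distinct (tl (T.awalk_verts w (p @ [(w', x), (x, w)])))"
    using x W' vs w by auto
  then have "T.cycle (p @ [(w', x), (x, w)])"
    using Tc by (auto simp: T.cycle_def)
  \<comment> \<open>Distinct ends give at least one arc in \<open>p\<close>; the two closing arcs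
    bring the length to at least 3.\<close>
  moreover have "p \<noteq> []" using Tw ne by (auto simp: T.awalk_simps)
  then have "3 \<le> length (p @ [(w', x), (x, w)])" by (cases p) auto
  ultimately show False using T by (auto simp: undirected_tree_def)
qed

text \<open>A walk from \<open>W\<close> to a vertex outside must leave \<open>W\<close> along some
  arc. This supplies the next vertex to embed and its parent.\<close>

lemma connected_exists_outgoing_arc:
  assumes "pair_graph T" "connected T" "W \<subset> pverts T" "W \<noteq> {}"
  shows "\<exists>w\<in>W. \<exists>x. x \<notin> W \<and> (w, x) \<in> parcs T"
proof -
  obtain u v where uv: "u \<in> W" "v \<in> pverts T" "v \<notin> W" using assms by blast
  then have "(u, v) \<in> rtrancl_on (pverts T) (parcs T)"
    using assms by (auto simp: connected_pair_graph)
  then have "v \<in> W \<or> (\<exists>w\<in>W. \<exists>x. x \<notin> W \<and> (w, x) \<in> parcs T)"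
    by (induction rule: rtrancl_on_induct) (use uv in auto)
  then show ?thesis using uv by simp
qed

lemma rtrancl_on_insert_neighbour:
  assumes "\<And>u v. u \<in> W \<Longrightarrow> v \<in> W \<Longrightarrow> (u, v) \<in> rtrancl_on W r"
    and w: "w \<in> W" "(w, x) \<in> r" "(x, w) \<in> r" and uv: "u \<in> insert x W" "v \<in> insert x W"
  shows "(u, v) \<in> rtrancl_on (insert x W) r"
proof -
  have W: "(a, b) \<in> rtrancl_on (insert x W) r" if "a \<in> W" "b \<in> W" for a b
    using rtrancl_on_mono[of r r W "insert x W" a b] assms(1)[OF that] by auto
  have "(w, x) \<in> rtrancl_on (insert x W) r" "(x, w) \<in> rtrancl_on (insert x W) r"
    using w rtrancl_on_into_rtrancl_on[OF W[OF w(1) w(1)]]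
      converse_rtrancl_on_into_rtrancl_on[OF _ W[OF w(1) w(1)]] by auto
  then have "(u, w) \<in> rtrancl_on (insert x W) r" "(w, v) \<in> rtrancl_on (insert x W) r"
    using uv W w(1) by blast+
  then show ?thesis by (rule rtrancl_on_trans)
qed


subsection \<open>Joins\<close>

text \<open>The family \<open>P\<close> keeps only the vertex sets of the joined graphs; the arcs
  inside a part stay arbitrary.\<close>

locale join_partition = pair_graph G for G :: "'a pair_pre_digraph" +
  fixes P :: "'a set set"
  assumes Union_parts: "\<Union>P = pverts G"
    and disjoint_parts: "C \<in> P \<Longrightarrow> D \<in> P \<Longrightarrow> C \<noteq> D \<Longrightarrow> C \<inter> D = {}"
    and adjacent: "C \<in> P \<Longrightarrow> u \<in> C \<Longrightarrow> v \<in> pverts G \<Longrightarrow> v \<notin> C \<Longrightarrow> (u, v) \<in> parcs G"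
begin

lemma finite_subset_verts: "A \<subseteq> pverts G \<Longrightarrow> finite A"
  by (rule finite_subset[OF _ pair_finite_verts])

lemma part_subset: "C \<in> P \<Longrightarrow> C \<subseteq> pverts G"
  using Union_parts by auto

text \<open>Vertices of different parts are adjacent. Two vertices of one part \<open>C\<close> have
  a common neighbour: any vertex of \<open>R\<close> outside \<open>C\<close>.\<close>

lemma induce_subgraph_connected:
  assumes R: "R \<subseteq> pverts G" "R \<noteq> {}" and meets: "\<And>C. C \<in> P \<Longrightarrow> \<not> R \<subseteq> C"
  shows "connected (G \<restriction> R)"
proof -
  define H where "H = \<lparr> pverts = R, parcs = parcs G \<inter> R \<times> R \<rparr>"
  have "pair_graph H"
    using finite_subset_verts[OF R(1)]
    by unfold_locales (auto simp: H_def symmetric_def sym_def dest: no_loops' arcs_symmetric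
      intro: finite_subset)
  moreover have "with_proj H = G \<restriction> R"
    by (auto simp: H_def induce_subgraph_def with_proj_def)
  moreover have "(u, v) \<in> rtrancl_on R (parcs G \<inter> R \<times> R)" if uv: "u \<in> R" "v \<in> R" for u v
  proof -
    have step: "(a, b) \<in> rtrancl_on R (parcs G \<inter> R \<times> R)"
      if "C \<in> P" "a \<in> R" "b \<in> R" "(a \<in> C) \<noteq> (b \<in> C)" for a b C
    proof (rule rtrancl_on_into_rtrancl_on)
      have "(a, b) \<in> parcs G"
        using that R adjacent[of C a b] adjacent[of C b a] arcs_symmetric[of b a] by blast
      then show "(a, b) \<in> parcs G \<inter> R \<times> R" using that by simp
    qed (use that in auto)
    obtain C where C: "C \<in> P" "u \<in> C" using uv R Union_parts by auto
    obtain w where w: "w \<in> R" "w \<notin> C" using meets[OF C(1)] by auto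
    show ?thesis
    proof (cases "v \<in> C")
      case True
      then have "(u, w) \<in> rtrancl_on R (parcs G \<inter> R \<times> R)" "(w, v) \<in> rtrancl_on R (parcs G \<inter> R \<times> R)"
        using step[OF C(1) uv(1) w(1)] step[OF C(1) w(1) uv(2)] C w by simp_all
      then show ?thesis by (rule rtrancl_on_trans)
    next
      case False
      then show ?thesis using step[OF C(1) uv] C by simp
    qed
  qed
  ultimately show ?thesis
    using R connected_pair_graph[of H] by (auto simp: H_def)
qed

text \<open>If deleting \<open>S\<close> leaves a disconnected graph or a single vertex, the
  remainder lies in one part \<open>C\<close>. Then \<open>S\<close> contains \<open>R - C\<close>,
  which has at least \<open>k\<close> vertices.\<close>

lemma induce_subgraph_k_connected:
  assumes R: "R \<subseteq> pverts G" "R \<noteq> {}" and k: "\<And>C. C \<in> P \<Longrightarrow> k \<le> card (R - C)"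
  shows "k_connected k (G \<restriction> R)"
proof -
  let ?Q = "\<lambda>n. \<exists>S. S \<subset> verts (G \<restriction> R) \<and> card S = n \<and>
     (\<not> connected ((G \<restriction> R) \<restriction> (verts (G \<restriction> R) - S)) \<or>
      graph_order ((G \<restriction> R) \<restriction> (verts (G \<restriction> R) - S)) = 1)"
  \<comment> \<open>Deleting all vertices but one shows that the minimum in the definition of
    connectivity is attained.\<close>
  obtain r where r: "r \<in> R" using R by auto
  then have "R - (R - {r}) = {r}" by auto
  then have "?Q (card (R - {r}))"
    using r by (intro exI[of _ "R - {r}"]) (auto simp: graph_order_def)
  then have "?Q (connectivity (G \<restriction> R))"
    unfolding connectivity_def by (rule LeastI)
  then obtain S where S: "S \<subset> R" "card S = connectivity (G \<restriction> R)"
    and bad: "\<not> connected ((G \<restriction> R) \<restriction> (R - S)) \<or> graph_order ((G \<restriction> R) \<restriction> (R - S)) = 1"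
    by auto
  have "(G \<restriction> R) \<restriction> (R - S) = G \<restriction> (R - S)"
    by (auto simp: induce_subgraph_def)
  then have bad': "\<not> connected (G \<restriction> (R - S)) \<or> card (R - S) = 1"
    using bad by (simp add: graph_order_def)
  have "\<exists>C\<in>P. R - S \<subseteq> C"
  proof (cases "card (R - S) = 1")
    case True
    then obtain x where x: "R - S = {x}" by (auto simp: card_1_singleton_iff)
    then have "x \<in> \<Union>P" using R Union_parts by auto
    then show ?thesis using x by auto
  next
    case False
    have "R - S \<subseteq> pverts G" "R - S \<noteq> {}" using S R by auto
    then show ?thesis
      using bad' False induce_subgraph_connected[of "R - S"] by metis
  qed
  then obtain C where C: "C \<in> P" "R - C \<subseteq> S" by auto
  have "finite S" using S R finite_subset_verts by auto
  then have "card (R - C) \<le> card S" using C by (intro card_mono)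
  then show ?thesis using k[OF C(1)] S by (auto simp: k_connected_def)
qed

text \<open>A new vertex uses up at most one unit of the budget of each part, and none of the budget
  of its own part. So only tight parts constrain the choice; there is at most one, and the new
  vertex is taken inside it.\<close>

lemma exists_next_vertex:
  assumes U: "U \<subseteq> pverts G" and n: "2 * k + card U < card (pverts G)"
    and inv: "\<And>C. C \<in> P \<Longrightarrow> card (U - C) + k \<le> card (pverts G - C)"
    and N: "\<not> N \<subseteq> U"
    and tight: "\<And>C. C \<in> P \<Longrightarrow> card (U - C) + k = card (pverts G - C) \<Longrightarrow> \<not> N \<inter> C \<subseteq> U"
  shows "\<exists>x\<in>N - U. \<forall>C\<in>P. card (insert x U - C) + k \<le> card (pverts G - C)"
proof -
  let ?tight = "\<lambda>C. card (U - C) + k = card (pverts G - C)"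
  have fin: "finite U" by (rule finite_subset_verts[OF U])
  \<comment> \<open>Since \<open>C\<close> and \<open>D\<close> are disjoint, \<open>A - C\<close>
    and \<open>A - D\<close> cover \<open>A\<close>.\<close>
  have eq: "card (A - C) + card (A - D) = card A + card (A - C - D)"
    if "C \<in> P" "D \<in> P" "C \<noteq> D" "finite A" for A C D
  proof -
    have "(A - C) \<union> (A - D) = A" "(A - C) \<inter> (A - D) = A - C - D"
      using disjoint_parts[OF that(1-3)] by auto
    then show ?thesis using card_Un_Int[of "A - C" "A - D"] that(4) by simp
  qed
  have one_tight: "C = D" if CD: "C \<in> P" "D \<in> P" "?tight C" "?tight D" for C D
  proof (rule ccontr)
    assume ne: "C \<noteq> D"
    \<comment> \<open>Adding both tightness equations and applying \<open>eq\<close> to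
      \<open>U\<close> and to the whole vertex set would give
      \<open>card (pverts G) \<le> 2 * k + card U\<close>.\<close>
    have "card (U - C - D) \<le> card (pverts G - C - D)"
      using U by (intro card_mono) auto
    then show False
      using eq[OF CD(1,2) ne fin] eq[OF CD(1,2) ne pair_finite_verts] CD n by linarith
  qed
  have loose: "card (insert x U - C) + k \<le> card (pverts G - C)" if "C \<in> P" "\<not> ?tight C" for x C
  proof -
    have "card (insert x U - C) \<le> card (insert x (U - C))"
      using fin by (intro card_mono) auto
    also have "\<dots> \<le> Suc (card (U - C))" by (rule card_insert_le_m1) auto
    finally show ?thesis using inv[OF that(1)] that(2) by linarith
  qed
  show ?thesis
  proof (cases "\<exists>C\<in>P. ?tight C")
    case True
    then obtain C where C: "C \<in> P" "?tight C" by auto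
    then obtain x where x: "x \<in> N" "x \<in> C" "x \<notin> U" using tight by blast
    have "card (insert x U - D) + k \<le> card (pverts G - D)" if D: "D \<in> P" for D
    proof (cases "D = C")
      case True
      then show ?thesis using x C by (simp add: insert_Diff_if)
    next
      case False
      then show ?thesis using loose[OF D] one_tight[OF D C(1)] C(2) by blast
    qed
    then show ?thesis using x by auto
  next
    case False
    then show ?thesis using N loose by blast
  qed
qed

text \<open>Greedy induction over connected vertex sets \<open>W\<close> of the tree: the budget of
  every part holds throughout, and the degree bound leaves an admissible free neighbour of the
  parent's image.\<close>

lemma exists_tree_embedding:
  fixes T :: "'b pair_pre_digraph"
  assumes T: "undirected_tree T" and n: "2 * k + card (pverts T) \<le> card (pverts G)"
    and deg: "\<And>v. v \<in> pverts G \<Longrightarrow> k + card (pverts T) \<le> card {w. (v, w) \<in> parcs G} + 1"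
    and parts: "\<And>C. C \<in> P \<Longrightarrow> k \<le> card (pverts G - C)"
  shows "\<exists>f. inj_on f (pverts T) \<and> f ` pverts T \<subseteq> pverts G \<and>
    (\<forall>(a, b) \<in> parcs T. (f a, f b) \<in> parcs G) \<and>
    (\<forall>C\<in>P. card (f ` pverts T - C) + k \<le> card (pverts G - C))"
proof -
  interpret T: pair_graph T using T by (simp add: undirected_tree_def)
  have conT: "connected T" using T by (simp add: undirected_tree_def)
  let ?ok = "\<lambda>U. \<forall>C\<in>P. card (U - C) + k \<le> card (pverts G - C)"
  have partial: "\<exists>W f. W \<subseteq> pverts T \<and> card W = Suc i \<and>
      (\<forall>u\<in>W. \<forall>v\<in>W. (u, v) \<in> rtrancl_on W (parcs T)) \<and> inj_on f W \<and> f ` W \<subseteq> pverts G \<and>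
      (\<forall>a\<in>W. \<forall>b\<in>W. (a, b) \<in> parcs T \<longrightarrow> (f a, f b) \<in> parcs G) \<and> ?ok (f ` W)"
    if "i < card (pverts T)" for i
    using that
  proof (induction i)
    case 0
    have "pverts T \<noteq> {}" using 0 by auto
    then obtain t where t: "t \<in> pverts T" by auto
    have "pverts G \<noteq> {}" using n 0 by auto
    \<comment> \<open>The first vertex may go anywhere, so the candidates are all vertices. A tight
      part without vertices would force \<open>k = card (pverts G)\<close>, against
      \<open>n\<close>.\<close>
    moreover have "\<not> pverts G \<inter> C \<subseteq> {}" if "C \<in> P" "card ({} - C) + k = card (pverts G - C)" for C
    proof
      assume "pverts G \<inter> C \<subseteq> {}"
      then have "pverts G - C = pverts G" by auto
      then show False using that n 0 by simp
    qed
    ultimately obtain v where v: "v \<in> pverts G" "?ok {v}"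
      using exists_next_vertex[of "{}" k "pverts G"] parts n 0 by auto
    show ?case
      by (rule exI[of _ "{t}"], rule exI[of _ "\<lambda>_. v"]) (use t v T.no_loops' in auto)
  next
    case (Suc i)
    then obtain W f where W: "W \<subseteq> pverts T" "card W = Suc i"
        and con: "\<And>u v. u \<in> W \<Longrightarrow> v \<in> W \<Longrightarrow> (u, v) \<in> rtrancl_on W (parcs T)"
        and f: "inj_on f W" "f ` W \<subseteq> pverts G"
        and arcs: "\<And>a b. a \<in> W \<Longrightarrow> b \<in> W \<Longrightarrow> (a, b) \<in> parcs T \<Longrightarrow> (f a, f b) \<in> parcs G"
        and ok: "?ok (f ` W)"
      by (metis Suc_lessD)
    have "W \<noteq> pverts T" "W \<noteq> {}" using W Suc.prems by auto
    then obtain w x where w: "w \<in> W" and x: "x \<notin> W" and wx: "(w, x) \<in> parcs T"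
      using connected_exists_outgoing_arc[of T W] T.pair_graph conT W by blast
    have xw: "(x, w) \<in> parcs T" using wx by (rule T.arcs_symmetric)
    define U where "U = f ` W"
    define N where "N = {y. (f w, y) \<in> parcs G}"
    have U: "U \<subseteq> pverts G" "finite U" "f w \<in> U" "card U = Suc i"
      using f w W finite_subset_verts by (auto simp: U_def card_image)
    have N: "N \<subseteq> pverts G" "f w \<notin> N"
      using in_arcsD2 no_loops' by (auto simp: N_def)
    have finN: "finite N" by (rule finite_subset_verts[OF N(1)])
    have degN: "k + card (pverts T) \<le> card N + 1"
      using deg[of "f w"] U by (auto simp: N_def)
    \<comment> \<open>The vertex \<open>f w\<close> lies in \<open>U\<close> but is not its own
      neighbour, so at most \<open>card U - 1\<close> of its neighbours are used.\<close>
    have "\<not> N \<subseteq> U"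
    proof
      assume "N \<subseteq> U"
      then have "card N \<le> card (U - {f w})" using U N by (intro card_mono) auto
      then show False using degN U Suc.prems by simp
    qed
    moreover have "\<not> N \<inter> C \<subseteq> U" if C: "C \<in> P" "card (U - C) + k = card (pverts G - C)" for C
    proof
      assume sub: "N \<inter> C \<subseteq> U"
      have cU: "card U = card (U \<inter> C) + card (U - C)" by (rule card_Int_Diff) (rule U)
      show False
      proof (cases "f w \<in> C")
        case True
        \<comment> \<open>Here \<open>N\<close> has at most \<open>card (U \<inter> C) - 1\<close>
          elements in \<open>C\<close> and, by tightness, at most \<open>card (U - C) + k\<close>
          outside. Together these are too few for the degree bound, as
          \<open>card U < card (pverts T)\<close>.\<close>
        have "card N = card (N \<inter> C) + card (N - C)" by (rule card_Int_Diff) (rule finN)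
        also have "card (N \<inter> C) \<le> card (U \<inter> C - {f w})"
          using sub N U by (intro card_mono) auto
        also have "card (N - C) \<le> card (pverts G - C)"
          using N pair_finite_verts by (intro card_mono) auto
        also have "card (U \<inter> C - {f w}) = card (U \<inter> C) - 1" using U True by simp
        finally have "card N \<le> card (U \<inter> C) - 1 + card (pverts G - C)" by simp
        moreover have "card (U \<inter> C) > 0" using U True by (auto simp: card_gt_0_iff)
        ultimately show False using degN cU C(2) U Suc.prems by linarith
      next
        case False
        \<comment> \<open>Now \<open>f w\<close> is adjacent to all of \<open>C\<close>, so
          \<open>C\<close> would be used up entirely. Tightness then gives
          \<open>card (pverts G) = card U + k\<close>, which is too small.\<close>
        have "C \<subseteq> N"
          using adjacent[OF C(1) _ _ False] U arcs_symmetric by (auto simp: N_def)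
        then have "C \<subseteq> U" using sub by auto
        then have "U \<inter> C = C" "pverts G \<inter> C = C" using U by auto
        then show False
          using cU C(2) U Suc.prems n card_Int_Diff[OF pair_finite_verts, of C] by simp
      qed
    qed
    moreover have "2 * k + card U < card (pverts G)" using n U Suc.prems by simp
    ultimately obtain y where y: "y \<in> N" "y \<notin> U" "?ok (insert y U)"
      using exists_next_vertex[of U k N] U N ok by (auto simp: U_def)
    define g where "g = f(x := y)"
    have g: "g a = f a" if "a \<in> W" for a using that x by (auto simp: g_def)
    have gx: "g x = y" by (simp add: g_def)
    have "g ` W = U" unfolding U_def by (rule image_cong[OF refl g])
    then have gW: "g ` insert x W = insert y U" using gx by simp
    have "inj_on g W" using f(1) inj_on_cong[of W g f] g by blast
    moreover have "g x \<notin> g ` (W - {x})" using y(2) \<open>g ` W = U\<close> gx by auto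
    ultimately have "inj_on g (insert x W)" by (simp only: inj_on_insert simp_thms)
    moreover have "(g a, g b) \<in> parcs G"
      if ab: "a \<in> insert x W" "b \<in> insert x W" "(a, b) \<in> parcs T" for a b
    proof -
      \<comment> \<open>The arcs between \<open>x\<close> and \<open>W\<close> are only those
        joining it to its parent \<open>w\<close>, and \<open>y\<close> was chosen adjacent to
        \<open>f w\<close>.\<close>
      have uniq: "c = w" if "c \<in> W" "(c, x) \<in> parcs T" for c
        using undirected_tree_unique_neighbour[OF T W(1) con x that w wx] by simp
      have yw: "(f w, y) \<in> parcs G" "(y, f w) \<in> parcs G"
        using y arcs_symmetric by (auto simp: N_def)
      consider "a \<in> W" "b \<in> W" | "a = x" "b \<in> W" | "a \<in> W" "b = x"
        using ab T.no_loops' by blast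
      then show ?thesis
      proof cases
        case 1
        then show ?thesis using arcs ab g by simp
      next
        case 2
        then have "b = w" using uniq ab T.arcs_symmetric by blast
        then show ?thesis using 2 g gx yw by simp
      next
        case 3
        then have "a = w" using uniq ab by blast
        then show ?thesis using 3 g gx yw by simp
      qed
    qed
    moreover have "\<forall>u\<in>insert x W. \<forall>v\<in>insert x W. (u, v) \<in> rtrancl_on (insert x W) (parcs T)"
      using rtrancl_on_insert_neighbour[OF con w wx xw] by blast
    moreover have "insert x W \<subseteq> pverts T" using W wx T.in_arcsD2 by auto
    moreover have "card (insert x W) = Suc (Suc i)"
      using W x by (metis card_insert_disjoint card.infinite nat.distinct(1))
    moreover have "g ` insert x W \<subseteq> pverts G" "?ok (g ` insert x W)"
      using gW y U N by auto
    ultimately show ?case by (intro exI[of _ "insert x W"] exI[of _ g]) simp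
  qed
  have "pverts T \<noteq> {}" using conT connected_pair_graph[OF T.pair_graph] by auto
  then have pos: "0 < card (pverts T)" using T.pair_finite_verts by (simp add: card_gt_0_iff)
  then have "card (pverts T) - 1 < card (pverts T)" by simp
  from partial[OF this] obtain W f where W: "W \<subseteq> pverts T" "card W = card (pverts T)"
      and f: "inj_on f W" "f ` W \<subseteq> pverts G"
      "\<forall>a\<in>W. \<forall>b\<in>W. (a, b) \<in> parcs T \<longrightarrow> (f a, f b) \<in> parcs G" "?ok (f ` W)"
    using pos by auto
  have "W = pverts T" using W T.pair_finite_verts by (intro card_subset_eq)
  then show ?thesis using f T.in_arcsD1 T.in_arcsD2 by (intro exI[of _ f]) auto
qed

end

section \<open>Cographs as joins of their cocomponents\<close>

lemma cograph_join_partition: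
  assumes "cograph G" "connected G" "graph_order G \<noteq> 1"
  shows "join_partition G (pverts ` cocomponents G)"
proof -
  interpret pair_graph G by (rule cograph_pair_graph) fact
  have D: "join_decomposition G (cocomponents G)"
    by (rule join_decomposition_cocomponents) fact+
  show ?thesis
  proof
    have "pverts G = pverts (Join (cocomponents G))"
      using D by (simp add: join_decomposition_def)
    then show Un: "\<Union>(pverts ` cocomponents G) = pverts G"
      by (simp add: Join_def)
    show "B \<inter> C = {}"
      if BC: "B \<in> pverts ` cocomponents G" "C \<in> pverts ` cocomponents G" "B \<noteq> C" for B C
    proof -
      obtain H K where HK: "H \<in> cocomponents G" "K \<in> cocomponents G" "B = pverts H" "C = pverts K"
        using BC by auto
      moreover have "H \<noteq> K" using HK BC(3) by auto
      ultimately show ?thesis using D by (simp add: join_decomposition_def pairwise_def)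
    qed
    show "(u, v) \<in> parcs G"
      if C: "C \<in> pverts ` cocomponents G" and uv: "u \<in> C" "v \<in> pverts G" "v \<notin> C" for C u v
    proof (rule ccontr)
      assume "(u, v) \<notin> parcs G"
      moreover obtain H where H: "H \<in> cocomponents G" "C = pverts H" using C by auto
      moreover have "u \<in> pverts G" unfolding Un[symmetric] using C uv(1) by (rule UnionI)
      ultimately show False using join_decomposition_same_part[OF D _ uv(2)] uv by simp
    qed
  qed
qed


subsection \<open>Degrees and connectivity\<close>

lemma (in pair_graph) min_degree_le_card_neighbours:
  assumes "v \<in> pverts G"
  shows "min_degree G \<le> card {w. (v, w) \<in> parcs G}"
proof -
  have "out_arcs G v = Pair v ` {w. (v, w) \<in> parcs G}"
    by (auto simp: out_arcs_def)
  then have "out_degree G v = card {w. (v, w) \<in> parcs G}"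
    by (simp add: out_degree_def card_image inj_on_def)
  moreover have "min_degree G \<le> out_degree G v"
    unfolding min_degree_def using assms pair_finite_verts by (intro Min_le) auto
  ultimately show ?thesis by simp
qed

text \<open>Of two disjoint components one has at most half of the vertices, and it contains each of
  its vertices together with all neighbours.\<close>

lemma disconnected_exists_low_degree:
  assumes "pair_graph H" "\<not> connected H" "pverts H \<noteq> {}"
  shows "\<exists>v\<in>pverts H. 2 * (card {w. (v, w) \<in> parcs H} + 1) \<le> card (pverts H)"
proof -
  interpret pair_graph H by fact
  \<comment> \<open>\<open>R u\<close> is the vertex set of the component of
    \<open>u\<close>.\<close>
  define R where "R u = {x. (u, x) \<in> rtrancl_on (pverts H) (parcs H)}" for u
  have sym: "sym (rtrancl_on (pverts H) (parcs H))"
    using arcs_symmetric by (intro rtrancl_on_sym symI)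
  obtain u v where uv: "u \<in> pverts H" "v \<in> pverts H" "v \<notin> R u"
    using assms by (auto simp: connected_pair_graph R_def)
  have R: "R x \<subseteq> pverts H" for x
    by (auto simp: R_def dest: in_rtrancl_on_in_F)
  then have finR: "finite (R x)" for x
    using pair_finite_verts finite_subset by blast
  have "x \<notin> R v" if "x \<in> R u" for x
  proof
    assume "x \<in> R v"
    then have "(x, v) \<in> rtrancl_on (pverts H) (parcs H)"
      using sym by (simp add: R_def symD)
    moreover have "(u, x) \<in> rtrancl_on (pverts H) (parcs H)" using that by (simp add: R_def)
    ultimately have "(u, v) \<in> rtrancl_on (pverts H) (parcs H)" by (rule rtrancl_on_trans[rotated])
    then show False using uv by (simp add: R_def)
  qed
  then have "R u \<inter> R v = {}" by auto
  then have "card (R u) + card (R v) = card (R u \<union> R v)"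
    using finR by (simp add: card_Un_disjoint)
  also have "\<dots> \<le> card (pverts H)"
    using R pair_finite_verts by (intro card_mono) auto
  finally have "2 * card (R u) \<le> card (pverts H) \<or> 2 * card (R v) \<le> card (pverts H)"
    by linarith
  then obtain x where x: "x \<in> pverts H" "2 * card (R x) \<le> card (pverts H)"
    using uv by blast
  have xx: "(x, x) \<in> rtrancl_on (pverts H) (parcs H)" using x by simp
  have "insert x {w. (x, w) \<in> parcs H} \<subseteq> R x"
    using rtrancl_on_into_rtrancl_on[OF xx] xx in_arcsD2 by (auto simp: R_def)
  then have "card (insert x {w. (x, w) \<in> parcs H}) \<le> card (R x)"
    using finR by (intro card_mono)
  moreover have "finite {w. (x, w) \<in> parcs H}"
    using in_arcsD2 by (intro finite_subset[OF _ pair_finite_verts]) auto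
  then have "card (insert x {w. (x, w) \<in> parcs H}) = card {w. (x, w) \<in> parcs H} + 1"
    using no_loops' by (subst card_insert_disjoint) auto
  ultimately have "2 * (card {w. (x, w) \<in> parcs H} + 1) \<le> card (pverts H)"
    using x(2) by simp
  then show ?thesis using x(1) by blast
qed

text \<open>For \<open>k = 1\<close> this is the convention on \<open>K\<^sub>1\<close>; it serves
  the case where the tree leaves just one vertex.\<close>

lemma k_connected_one_vertex:
  assumes "card R = 1" "k \<le> 1"
  shows "k_connected k (G \<restriction> R)"
  using assms by (cases "k = 0") (auto simp: k_connected_def graph_order_def)

lemma induce_cocomponent:
  assumes "join_decomposition G D" "H \<in> D"
  shows "G \<restriction> pverts H = H"
proof -
  have "{e \<in> parcs G. fst e \<in> pverts H \<and> snd e \<in> pverts H} = parcs H"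
    unfolding join_decomposition_arcs[OF assms] by auto
  then show ?thesis by (simp add: induce_subgraph_def with_proj_def)
qed

text \<open>Deleting everything outside a cocomponent leaves a disconnected graph or a single
  vertex, so the deleted set is counted in the minimum defining
  \<open>connectivity G\<close>.\<close>

lemma k_connected_card_outside_cocomponent:
  assumes D: "join_decomposition G D" and H: "H \<in> D"
    and k: "k_connected k G" "graph_order G \<noteq> 1"
  shows "k \<le> card (pverts G - pverts H)"
proof -
  have "cograph H" and "pverts G = pverts (Join D)"
    using D H by (simp_all add: join_decomposition_def)
  then have "pverts H \<subseteq> pverts G" "pverts H \<noteq> {}"
    using H cograph_nonempty by (auto simp: Join_def)
  then have "pverts G - (pverts G - pverts H) = pverts H" "pverts G - pverts H \<subset> pverts G" by auto
  moreover have "\<not> connected H \<or> graph_order H = 1"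
    using D H by (simp add: join_decomposition_def) blast
  ultimately have "connectivity G \<le> card (pverts G - pverts H)"
    unfolding connectivity_def using induce_cocomponent[OF D H]
    by (intro Least_le exI[of _ "pverts G - pverts H"]) auto
  then show ?thesis using k by (auto simp: k_connected_def)
qed

text \<open>A vertex in a smallest component of \<open>H\<close> has at most
  \<open>card (pverts H) / 2 - 1\<close> neighbours in \<open>H\<close>, and at most all vertices
  outside \<open>H\<close> besides. Doubling avoids the fraction.\<close>

lemma min_degree_bound_disconnected_cocomponent:
  assumes G: "pair_graph G" and D: "join_decomposition G D" and H: "H \<in> D" "graph_order H \<noteq> 1"
  shows "2 * min_degree G + card (pverts H) + 2 \<le> 2 * card (pverts G)"
proof -
  interpret pair_graph G by fact
  have "cograph H" "\<not> connected H" using D H by (auto simp: join_decomposition_def)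
  then obtain v where v: "v \<in> pverts H" "2 * (card {w. (v, w) \<in> parcs H} + 1) \<le> card (pverts H)"
    using disconnected_exists_low_degree cograph_pair_graph cograph_nonempty by blast
  have "pverts G = pverts (Join D)"
    using D by (simp add: join_decomposition_def)
  then have HG: "pverts H \<subseteq> pverts G"
    using H by (auto simp: Join_def)
  have fin: "finite (pverts H)" using HG pair_finite_verts by (rule finite_subset)
  have "{w. (v, w) \<in> parcs G} \<subseteq> {w. (v, w) \<in> parcs H} \<union> (pverts G - pverts H)"
    unfolding join_decomposition_arcs[OF D H(1)] using v(1) in_arcsD2 by blast
  moreover have "{w. (v, w) \<in> parcs H} \<subseteq> pverts H"
    unfolding join_decomposition_arcs[OF D H(1)] by blast
  ultimately have "card {w. (v, w) \<in> parcs G} \<le> card ({w. (v, w) \<in> parcs H} \<union> (pverts G - pverts H))"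
    using finite_subset[OF _ fin] pair_finite_verts by (intro card_mono) simp_all
  also have "\<dots> \<le> card {w. (v, w) \<in> parcs H} + card (pverts G - pverts H)"
    by (rule card_Un_le)
  finally have "card {w. (v, w) \<in> parcs G} \<le>
    card {w. (v, w) \<in> parcs H} + card (pverts G - pverts H)" .
  moreover have "min_degree G \<le> card {w. (v, w) \<in> parcs G}"
    using v HG by (intro min_degree_le_card_neighbours) auto
  moreover have "card (pverts G - pverts H) + card (pverts H) = card (pverts G)"
    using HG fin card_mono[OF pair_finite_verts HG] by (simp add: card_Diff_subset)
  ultimately show ?thesis using v(2) by simp
qed


section \<open>From the degree hypothesis to the budgets and the subtree\<close>

theorem theorem6:
  fixes k m :: nat and T :: "'b pair_pre_digraph" and G :: "'a pair_pre_digraph"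
  assumes "1 \<le> k" and "1 \<le> m"
    and "undirected_tree T" and "graph_order T = m"
    and "cograph G" and "k_connected k G"
    and "min_degree G \<ge>
      (if primary_order G = 1 then k + m - of_bool (k = 1)
       else if 2 \<le> primary_order G \<and> primary_order G \<le> k then k + m - 1 + primary_order G div 2
       else if k < primary_order G \<and> primary_order G < k + m then 3 * k div 2 + m - 1
       else k + m - 1)"
  shows "\<exists>T'. undirected_tree T' \<and> subgraph T' G \<and> digraph_iso T' T \<and>
      pverts T' \<subset> pverts G \<and> k_connected k (G \<restriction> (pverts G - pverts T'))"
proof -
  define V where "V = pverts G"
  define q where "q = primary_order G"
  interpret G: pair_graph G by (rule cograph_pair_graph) fact
  interpret T: pair_graph T using assms(3) by (simp add: undirected_tree_def)
  have m: "card (pverts T) = m" using assms(4) by (simp add: graph_order_def)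
  have finV: "finite V" unfolding V_def by (rule G.pair_finite_verts)
  have deg_bound: "min_degree G + 1 \<le> card V"
  proof -
    obtain v where v: "v \<in> V" using cograph_nonempty[OF assms(5)] by (auto simp: V_def)
    then have "{w. (v, w) \<in> parcs G} \<subseteq> V - {v}"
      using G.in_arcsD2 G.no_loops' by (auto simp: V_def)
    then have "card {w. (v, w) \<in> parcs G} \<le> card (V - {v})"
      using finV by (intro card_mono) auto
    moreover have "card (V - {v}) + 1 = card V" using card_Suc_Diff1[OF finV v] by simp
    ultimately show ?thesis
      using G.min_degree_le_card_neighbours[of v] v by (auto simp: V_def)
  qed
  \<comment> \<open>Each of the four cases yields at least \<open>k + m - 1\<close>; the Iverson
    bracket subtracts at most 1.\<close>
  have deg_pos: "k + m \<le> min_degree G + 1"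
    using assms(1,2,7) by (cases "k = 1") (auto split: if_splits)
  have order: "graph_order G \<noteq> 1"
  proof
    assume 1: "graph_order G = 1"
    then have "min_degree G = 0" using deg_bound by (simp add: graph_order_def V_def)
    moreover have "primary_order G = 1" using 1 by (simp add: primary_order_def cocomponents_def)
    ultimately show False using assms(1,2,7) by (cases "k = 1") auto
  qed
  \<comment> \<open>Otherwise the empty set would be a separator and the connectivity 0.\<close>
  have con: "connected G"
  proof (rule ccontr)
    assume "\<not> connected G"
    moreover have "pverts G - {} = pverts G" "{} \<subset> pverts G" using cograph_nonempty[OF assms(5)] by auto
    moreover have "G \<restriction> pverts G = with_proj G"
      using G.in_arcsD1 G.in_arcsD2 by (auto simp: induce_subgraph_def with_proj_def)
    ultimately have "connectivity G \<le> 0"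
      unfolding connectivity_def by (intro Least_le exI[of _ "{}"]) auto
    then show False using assms(1,6) order by (auto simp: k_connected_def)
  qed
  interpret join_partition G "pverts ` cocomponents G"
    by (rule cograph_join_partition) fact+
  let ?P = "pverts ` cocomponents G"
  have D: "join_decomposition G (cocomponents G)"
    by (rule join_decomposition_cocomponents) fact+
  have fin: "finite (cocomponents G)" and ne: "cocomponents G \<noteq> {}"
    using D by (auto simp: join_decomposition_def)
  have le_q: "card C \<le> q" if "C \<in> ?P" for C
    using that fin by (auto simp: q_def primary_order_def graph_order_def)
  have "q \<in> (\<lambda>H. graph_order (with_proj H)) ` cocomponents G"
    unfolding q_def primary_order_def using fin ne by (intro Max_in) auto
  then obtain H where H: "H \<in> cocomponents G" "card (pverts H) = q"
    by (auto simp: graph_order_def)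
  have HG: "pverts H \<subseteq> V" using part_subset H by (auto simp: V_def)
  have "pverts H \<noteq> {}" using D H by (auto simp: join_decomposition_def dest: cograph_nonempty)
  then have "1 \<le> q" using H HG finV by (metis One_nat_def Suc_leI card_gt_0_iff finite_subset)
  have half: "2 * min_degree G + q + 2 \<le> 2 * card V" if "q \<noteq> 1"
    using min_degree_bound_disconnected_cocomponent[OF G.pair_graph D H(1)] that H(2)
    by (simp add: graph_order_def V_def)
  have outside: "k \<le> card (V - C)" if "C \<in> ?P" for C
    using that k_connected_card_outside_cocomponent[OF D _ assms(6) order] by (auto simp: V_def)
  have qk: "k + q \<le> card V"
    using outside[of "pverts H"] H HG finV card_mono[OF finV HG]
    by (simp add: card_Diff_subset finite_subset)
  \<comment> \<open>For \<open>q \<le> k\<close> any placement of the tree works, so no budget has to be imposed.\<close>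
  define l where "l = (if q \<le> k then 0 else k)"
  \<comment> \<open>For \<open>q = 1\<close> this follows from \<open>deg_bound\<close>, the
    exception arising from the bracket. For \<open>q \<ge> 2\<close>, \<open>half\<close> gives
    \<open>2 * (k + m + q) - 1 \<le> 2 * card V\<close> even when \<open>q\<close> is odd, and
    parity removes the 1.\<close>
  have small: "m + q + k \<le> card V \<or> k = 1 \<and> card V = m + 1" if "q \<le> k"
    using that half deg_bound assms(1,2,7) \<open>1 \<le> q\<close> unfolding q_def[symmetric]
    by (cases "q = 1"; cases "k = 1") (auto split: if_splits)
  \<comment> \<open>Below \<open>k + m\<close>, the floor of \<open>3 * k / 2\<close> loses at most
    1 after doubling, which \<open>q \<ge> k + 1\<close> compensates in \<open>half\<close>. From
    \<open>k + m\<close> on, \<open>k + q \<le> card V\<close> suffices.\<close>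
  have large: "2 * k + m \<le> card V" if "\<not> q \<le> k"
  proof (cases "q < k + m")
    case True
    then have "3 * k div 2 + m \<le> min_degree G + 1"
      using that assms(1,2,7) unfolding q_def[symmetric] by auto
    then show ?thesis using half that assms(1) by linarith
  next
    case False
    then show ?thesis using qk by simp
  qed
  have "\<exists>f. inj_on f (pverts T) \<and> f ` pverts T \<subseteq> V \<and>
    (\<forall>(a, b) \<in> parcs T. (f a, f b) \<in> parcs G) \<and>
    (\<forall>C\<in>?P. card (f ` pverts T - C) + l \<le> card (V - C))"
    unfolding V_def
  proof (rule exists_tree_embedding)
    show "2 * l + card (pverts T) \<le> card (pverts G)"
      using small large m unfolding l_def V_def by (auto split: if_splits)
    show "l + card (pverts T) \<le> card {w. (v, w) \<in> parcs G} + 1" if "v \<in> pverts G" for v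
      using G.min_degree_le_card_neighbours[OF that] deg_pos m by (simp add: l_def)
    show "l \<le> card (pverts G - C)" if "C \<in> ?P" for C
      using outside[OF that] by (simp add: l_def V_def)
  qed fact
  then obtain f where f: "inj_on f (pverts T)" "f ` pverts T \<subseteq> V"
      "\<forall>(a, b) \<in> parcs T. (f a, f b) \<in> parcs G"
      "\<forall>C\<in>?P. card (f ` pverts T - C) + l \<le> card (V - C)"
    by (elim exE conjE) (rule that)
  define U where "U = f ` pverts T"
  have U: "U \<subseteq> V" "card U = m" "finite U"
    using f m finV by (auto simp: U_def card_image intro: finite_subset)
  have cR: "card (V - U) + m = card V"
    using U finV card_mono[OF finV U(1)] by (simp add: card_Diff_subset)
  have m_less: "m < card V" using small large assms(1) by (cases "q \<le> k") auto
  have remain: "k_connected k (G \<restriction> (V - U))"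
  \<comment> \<open>The exceptional case of \<open>small\<close> leaves a single vertex, so the
    convention on \<open>K\<^sub>1\<close> applies.\<close>
  proof (cases "q \<le> k \<and> k = 1 \<and> card V = m + 1")
    case True
    then show ?thesis using cR by (intro k_connected_one_vertex) auto
  next
    case False
    show ?thesis
    proof (rule induce_subgraph_k_connected)
      show "V - U \<subseteq> pverts G" by (auto simp: V_def)
      have "0 < card (V - U)" using cR m_less by linarith
      then show "V - U \<noteq> {}" by (auto simp: card_gt_0_iff)
      fix C assume C: "C \<in> ?P"
      then have CV: "C \<subseteq> V" using part_subset by (simp add: V_def)
      show "k \<le> card (V - U - C)"
      proof (cases "q \<le> k")
        case True
        \<comment> \<open>Plain counting: at least \<open>card V - m - q\<close> vertices survive
          outside \<open>C\<close>, and this is at least \<open>k\<close> by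
          \<open>small\<close>.\<close>
        have "card (V - U) - card C \<le> card (V - U - C)"
          using CV finV by (intro diff_card_le_card_Diff) (rule finite_subset)
        then show ?thesis using small[OF True] False True cR le_q[OF C] by linarith
      next
        case qk: False
        have "V - U - C = (V - C) - (U - C)" by auto
        then have "card (V - U - C) = card (V - C) - card (U - C)"
          using U finV by (simp add: card_Diff_subset Diff_mono)
        then show ?thesis using bspec[OF f(4) C] qk by (simp add: U_def l_def)
      qed
    qed
  qed
  define T' where "T' = \<lparr> pverts = U, parcs = map_prod f f ` parcs T \<rparr>"
  have T': "undirected_tree T'" "digraph_iso T' T"
    using undirected_tree_image[OF assms(3) f(1)] by (simp_all add: T'_def U_def)
  then interpret T': pair_graph T' by (simp add: undirected_tree_def)
  have "subgraph T' G"
    using U f(3) T'.wf_digraph_axioms G.wf_digraph_axioms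
    by (auto simp: subgraph_def T'_def V_def)
  moreover have "pverts T' \<subset> pverts G" using U m_less by (auto simp: T'_def V_def)
  moreover have "k_connected k (G \<restriction> (pverts G - pverts T'))"
    using remain by (simp add: T'_def V_def)
  ultimately show ?thesis using T' by blast
qed

end
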